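(* For each field $\mathbb{F}$ and each integer $t\ge3$, for all sufficiently large $n$, there exists a symmetric matrix $A\in\{0,1\}^{n\times n}$ with ones on the diagonal such that $\mathrm{him}(A)\le 2t$, and every matrix $B\in\mathbb{F}^{n\times n}$ with the same support as $A$ (i.e., $B_{i,j}=0\iff A_{i,j}=0$) has rank at least $n^{1-2/t}$.
   Context: For a $0/1$ matrix $M$, $\mathrm{him}(M)$ is the largest $r$ such that, after selecting $r$ distinct rows and $r$ distinct columns of $M$ (in some order), the resulting $r\times r$ submatrix is triangular (all entries below, or all entries above, the diagonal are $0$) with all diagonal entries equal to $1$. *)

theory Defs
  imports Complex_Main "Jordan_Normal_Form.DL_Rank"
begin

definition select_mat :: "'a mat \<Rightarrow> nat \<Rightarrow> (nat \<Rightarrow> nat) \<Rightarrow> (nat \<Rightarrow> nat) \<Rightarrow> 'a mat" where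
  "select_mat M r f g = mat r r (\<lambda>(i, j). M $$ (f i, g j))"

text \<open>The injections \<open>f\<close> and \<open>g\<close> carry the (independent) orders in which the selected rows and
  columns are listed.\<close>

definition has_half_induced_matching :: "int mat \<Rightarrow> nat \<Rightarrow> bool" where
  "has_half_induced_matching M r \<longleftrightarrow>
     (\<exists>f g. inj_on f {..<r} \<and> f ` {..<r} \<subseteq> {..<dim_row M} \<and>
            inj_on g {..<r} \<and> g ` {..<r} \<subseteq> {..<dim_col M} \<and>
            (upper_triangular (select_mat M r f g) \<or>
             upper_triangular (transpose_mat (select_mat M r f g))) \<and>
            (\<forall>i<r. select_mat M r f g $$ (i, i) = 1))"

definition him :: "int mat \<Rightarrow> nat" where
  "him M = Max {r. has_half_induced_matching M r}"

text \<open>The maximum is over a finite nonempty set.\<close>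

lemma has_half_induced_matching_0: "has_half_induced_matching M 0"
  by (auto simp: has_half_induced_matching_def select_mat_def upper_triangular_def)

lemma has_half_induced_matching_le:
  assumes "has_half_induced_matching M r"
  shows "r \<le> dim_row M"
proof -
  obtain f where "inj_on f {..<r}" "f ` {..<r} \<subseteq> {..<dim_row M}"
    using assms unfolding has_half_induced_matching_def by blast
  then have "card {..<r} \<le> card {..<dim_row M}"
    by (intro card_inj_on_le) auto
  then show ?thesis by simp
qed

lemma finite_half_induced_matching: "finite {r. has_half_induced_matching M r}"
  by (rule finite_subset[of _ "{..dim_row M}"]) (auto dest: has_half_induced_matching_le)

lemma him_le_iff: "him M \<le> k \<longleftrightarrow> (\<forall>r. has_half_induced_matching M r \<longrightarrow> r \<le> k)"
  unfolding him_def using has_half_induced_matching_0[of M]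
  by (subst Max_le_iff[OF finite_half_induced_matching]) auto

definition zero_one_mat :: "int mat \<Rightarrow> bool" where
  "zero_one_mat M \<longleftrightarrow> elements_mat M \<subseteq> {0, 1}"

definition same_support :: "'a::zero mat \<Rightarrow> 'b::zero mat \<Rightarrow> bool" where
  "same_support A B \<longleftrightarrow> dim_row A = dim_row B \<and> dim_col A = dim_col B \<and>
     (\<forall>i<dim_row A. \<forall>j<dim_col A. B $$ (i, j) = 0 \<longleftrightarrow> A $$ (i, j) = 0)"

end

theory Submission
  imports Defs "HOL-Library.Function_Algebras" "HOL-Real_Asymp.Real_Asymp"
begin

text \<open>
  View the zeros of \<open>A\<close> as the edges of a graph. A triangular submatrix of order \<open>2 t + 1\<close> yields a
  half graph: edges \<open>a i ~ b j\<close> for all \<open>j \<le> i < 2 t\<close>. It has \<open>4 t\<close> vertices and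
  \<open>t (2 t + 1)\<close> distinct edges, so colouring the edges of the complete graph at random with
  \<open>q \<approx> n powr ((4 t + 1) / (2 t\<^sup>2 + t - 1))\<close> colours leaves no monochromatic half graph, and some
  colour class \<open>S\<close> has at least \<open>(n choose 2) / q\<close> edges. Every subset of \<open>S\<close> is half-graph-free as
  well, so there are \<open>2 ^ card S\<close> admissible matrices. On the other hand, the matrices of rank at
  most \<open>k\<close> are the products of an \<open>n \<times> k\<close> and a \<open>k \<times> n\<close> matrix, and the zero-pattern argument of
  Ronyai, Babai and Ganapathy shows that they have at most \<open>(n\<^sup>2 + 1) ^ (2 n k)\<close> supports. For
  \<open>k = n powr (1 - 2 / t)\<close> this number is smaller than \<open>2 ^ card S\<close>, because
  \<open>(4 t + 1) / (2 t\<^sup>2 + t - 1) < 2 / t\<close> exactly when \<open>t > 2\<close>.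
\<close>

section \<open>Independent sets in uniform hypergraphs\<close>

text \<open>Union bound over all colourings of \<open>V\<close> with \<open>q\<close> colours: the
  bound on \<open>card I\<close> leaves a colouring in which no \<open>h i\<close> is monochromatic,
  and a colour class of at least average size is independent.\<close>

lemma exists_large_independent_set:
  fixes h :: "'i \<Rightarrow> 'v set"
  assumes V: "finite V" and I: "finite I" and h: "\<And>i. i \<in> I \<Longrightarrow> h i \<subseteq> V"
    and e: "\<And>i. i \<in> I \<Longrightarrow> card (h i) = e" "e > 0" and q: "q > 0" "card I < q ^ (e - 1)"
  shows "\<exists>S\<subseteq>V. (\<forall>i\<in>I. \<not> h i \<subseteq> S) \<and> card V \<le> q * card S"
proof (cases "I = {}")
  case True
  then show ?thesis using q by (intro exI[of _ V]) auto
next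
  case False
  then have eV: "e \<le> card V" using h e V by (metis card_mono equals0I)
  let ?C = "V \<rightarrow>\<^sub>E {..<q}"
  define bad where "bad = (\<lambda>(i, c). {\<phi> \<in> ?C. \<forall>v\<in>h i. \<phi> v = c})"
  have card_bad: "card (bad p) \<le> q ^ (card V - e)" if p: "p \<in> I \<times> {..<q}" for p
  proof -
    obtain i c where ic: "p = (i, c)" "i \<in> I" using p by auto
    \<comment> \<open>A colouring in \<open>bad p\<close> is constantly \<open>c\<close> on
      \<open>h i\<close>, so its values off \<open>h i\<close> determine it.\<close>
    have "inj_on (\<lambda>\<phi>. restrict \<phi> (V - h i)) (bad p)"
    proof (rule inj_onI)
      fix \<phi> \<psi> assume *: "\<phi> \<in> bad p" "\<psi> \<in> bad p" "restrict \<phi> (V - h i) = restrict \<psi> (V - h i)"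
      then have "\<phi> \<in> ?C" "\<psi> \<in> ?C" by (auto simp: bad_def ic)
      then show "\<phi> = \<psi>"
      proof (rule PiE_ext)
        fix v assume "v \<in> V"
        show "\<phi> v = \<psi> v"
        proof (cases "v \<in> h i")
          case True
          then show ?thesis using * by (auto simp: bad_def ic)
        next
          case False
          then show ?thesis using fun_cong[OF *(3), of v] \<open>v \<in> V\<close> by auto
        qed
      qed
    qed
    moreover have "(\<lambda>\<phi>. restrict \<phi> (V - h i)) ` bad p \<subseteq> (V - h i) \<rightarrow>\<^sub>E {..<q}"
      by (auto simp: bad_def ic)
    ultimately have "card (bad p) \<le> card ((V - h i) \<rightarrow>\<^sub>E {..<q})"
      by (rule card_inj_on_le) (use V in \<open>auto intro!: finite_PiE\<close>)
    also have "\<dots> = q ^ (card V - e)"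
      using V h[OF ic(2)] e(1)[OF ic(2)] by (simp add: card_funcsetE card_Diff_subset finite_subset)
    finally show ?thesis .
  qed
  have "card (\<Union>p\<in>I \<times> {..<q}. bad p) \<le> (\<Sum>p\<in>I \<times> {..<q}. card (bad p))"
    using I by (intro card_UN_le) auto
  also have "\<dots> \<le> card (I \<times> {..<q}) * q ^ (card V - e)"
    using sum_bounded_above[of "I \<times> {..<q}" "\<lambda>p. card (bad p)" "q ^ (card V - e)"] card_bad by auto
  also have "\<dots> = card I * (q * q ^ (card V - e))" by (simp add: card_cartesian_product)
  also have "\<dots> < q ^ (e - 1) * (q * q ^ (card V - e))" using q by simp
  also have "\<dots> = q ^ ((e - 1) + 1 + (card V - e))" by (simp only: power_add power_one_right mult.assoc)
  also have "(e - 1) + 1 + (card V - e) = card V" using eV e(2) by simp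
  also have "q ^ card V = card ?C" using V by (simp add: card_funcsetE)
  finally have less: "card (\<Union>p\<in>I \<times> {..<q}. bad p) < card ?C" .
  have "bad p \<subseteq> ?C" for p by (auto simp: bad_def split: prod.splits)
  then have "finite (\<Union>p\<in>I \<times> {..<q}. bad p)"
    using V by (auto intro!: finite_subset[of _ ?C] finite_PiE)
  with less have "\<not> ?C \<subseteq> (\<Union>p\<in>I \<times> {..<q}. bad p)" by (metis card_mono leD)
  then obtain \<phi> where \<phi>: "\<phi> \<in> ?C" "\<And>i c. i \<in> I \<Longrightarrow> c < q \<Longrightarrow> \<phi> \<notin> bad (i, c)" by blast
  let ?S = "\<lambda>c. {v \<in> V. \<phi> v = c}"
  have "\<exists>c<q. card V \<le> q * card (?S c)"
  proof (rule ccontr)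
    assume "\<not> ?thesis"
    then have less: "q * card (?S c) < card V" if "c < q" for c using that by (auto simp: not_le)
    have "V = (\<Union>c\<in>{..<q}. ?S c)" using \<phi>(1) by auto
    then have "card V = (\<Sum>c<q. card (?S c))"
      using V by (subst card_UN_disjoint[symmetric]) auto
    then have "q * card V = (\<Sum>c<q. q * card (?S c))" by (simp add: sum_distrib_left)
    also have "\<dots> < (\<Sum>c<q. card V)" using less q by (intro sum_strict_mono) auto
    finally show False by simp
  qed
  then obtain c where "c < q" "card V \<le> q * card (?S c)" by blast
  moreover have "\<not> h i \<subseteq> ?S c" if "i \<in> I" for i
    using \<phi> \<open>c < q\<close> that by (auto simp: bad_def)
  ultimately show ?thesis by (intro exI[of _ "?S c"]) auto
qed

section \<open>Zero patterns of polynomials\<close>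

interpretation fun_space: vector_space "\<lambda>(c::'a::field) (f :: 'b \<Rightarrow> 'a) x. c * f x"
  by standard (auto simp: fun_eq_iff algebra_simps)

lemma sum_fun_apply: "(\<Sum>i\<in>A. f i) x = (\<Sum>i\<in>A. f i x)"
  for f :: "'i \<Rightarrow> 'b \<Rightarrow> 'a::comm_monoid_add"
  by (induction A rule: infinite_finite_induct) auto

text \<open>Multiplication is bilinear, so multiplying generators is enough; the inductions treat
  one factor at a time.\<close>

lemma span_times:
  fixes f g :: "'b \<Rightarrow> 'a::field"
  assumes f: "f \<in> fun_space.span S" and g: "g \<in> fun_space.span T"
    and ST: "\<And>s t. s \<in> S \<Longrightarrow> t \<in> T \<Longrightarrow> s * t \<in> fun_space.span U"
  shows "f * g \<in> fun_space.span U"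
proof -
  have *: "s * g \<in> fun_space.span U" if s: "s \<in> S" for s
    using g
  proof (induction rule: fun_space.span_induct_alt)
    case base
    show ?case using fun_space.span_zero[of U] by (simp add: zero_fun_def times_fun_def)
  next
    case (step c t y)
    have "s * ((\<lambda>x. c * t x) + y) = (\<lambda>x. c * (s * t) x) + s * y"
      by (auto simp: fun_eq_iff algebra_simps)
    then show ?case
      using fun_space.span_add[OF fun_space.span_scale[OF ST[OF s step(1)], of c] step(2)] by (simp only:)
  qed
  show ?thesis using f
  proof (induction rule: fun_space.span_induct_alt)
    case base
    show ?case using fun_space.span_zero[of U] by (simp add: zero_fun_def times_fun_def)
  next
    case (step c s y)
    have "((\<lambda>x. c * s x) + y) * g = (\<lambda>x. c * (s * g) x) + y * g"
      by (auto simp: fun_eq_iff algebra_simps)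
    then show ?case
      using fun_space.span_add[OF fun_space.span_scale[OF *[OF step(1)], of c] step(2)] by (simp only:)
  qed
qed

text \<open>Polynomials are represented as functions, which makes the linear independence below valid over
  finite fields too; the degree bound \<open>d\<close> applies to each variable separately.\<close>

definition monomials :: "'v set \<Rightarrow> nat \<Rightarrow> (('v \<Rightarrow> 'a::field) \<Rightarrow> 'a) set" where
  "monomials V d = (\<lambda>e x. \<Prod>v\<in>V. x v ^ e v) ` (V \<rightarrow>\<^sub>E {..d})"

lemma finite_monomials: "finite V \<Longrightarrow> finite (monomials V d)"
  unfolding monomials_def by (intro finite_imageI finite_PiE) auto

lemma card_monomials_le:
  assumes "finite V"
  shows "card (monomials V d) \<le> (d + 1) ^ card V"
proof -
  have "card (monomials V d) \<le> card (V \<rightarrow>\<^sub>E {..d})"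
    unfolding monomials_def using assms by (intro card_image_le finite_PiE) auto
  then show ?thesis using assms by (simp add: card_funcsetE)
qed

lemma monomialI:
  assumes "\<And>v. v \<in> V \<Longrightarrow> e v \<le> d"
  shows "(\<lambda>x. \<Prod>v\<in>V. x v ^ e v) \<in> monomials V d"
  unfolding monomials_def
  by (rule image_eqI[of _ _ "restrict e V"]) (use assms in \<open>auto simp: fun_eq_iff intro!: prod.cong\<close>)

lemma monomials_mono: "d \<le> d' \<Longrightarrow> monomials V d \<subseteq> monomials V d'"
  unfolding monomials_def by (intro image_mono PiE_mono) auto

lemma monomials_times:
  assumes "s \<in> monomials V d" "t \<in> monomials V d'"
  shows "s * t \<in> monomials V (d + d')"
proof -
  obtain e e' where s: "s = (\<lambda>x. \<Prod>v\<in>V. x v ^ e v)" "e \<in> V \<rightarrow>\<^sub>E {..d}"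
    and t: "t = (\<lambda>x. \<Prod>v\<in>V. x v ^ e' v)" "e' \<in> V \<rightarrow>\<^sub>E {..d'}"
    using assms unfolding monomials_def by auto
  have "s * t = (\<lambda>x. \<Prod>v\<in>V. x v ^ (e v + e' v))"
    unfolding s t by (simp add: fun_eq_iff power_add prod.distrib)
  also have "\<dots> \<in> monomials V (d + d')"
    using s t by (intro monomialI add_mono) auto
  finally show ?thesis .
qed

text \<open>Each factor has degree at most one in every variable, so it raises the bound for each
  variable by one.\<close>

lemma prod_in_span_monomials:
  fixes f :: "'i \<Rightarrow> ('v \<Rightarrow> 'a::field) \<Rightarrow> 'a"
  assumes "finite J" "\<And>i. i \<in> J \<Longrightarrow> f i \<in> fun_space.span (monomials V 1)"
  shows "(\<lambda>x. \<Prod>i\<in>J. f i x) \<in> fun_space.span (monomials V (card J))"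
  using assms
proof (induction J)
  case empty
  have "(\<lambda>x :: 'v \<Rightarrow> 'a. \<Prod>v\<in>V. x v ^ 0) \<in> monomials V 0" by (rule monomialI) auto
  then show ?case by (simp add: fun_space.span_base)
next
  case (insert i J)
  have "f i * (\<lambda>x. \<Prod>i\<in>J. f i x) \<in> fun_space.span (monomials V (1 + card J))"
    by (rule span_times[of _ "monomials V 1" _ "monomials V (card J)"])
      (use insert in \<open>auto intro!: fun_space.span_base monomials_times simp del: One_nat_def plus_1_eq_Suc\<close>)
  then show ?case using insert by (simp add: times_fun_def)
qed

text \<open>For every realised pattern \<open>p\<close>, take the product of the \<open>f i\<close>
  with \<open>i \<in> p\<close>. These products are linearly independent and lie in the span of at
  most \<open>(card I + 1) ^ card V\<close> monomials.\<close>

lemma card_zero_patterns_le: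
  fixes f :: "'i \<Rightarrow> ('v \<Rightarrow> 'a::field) \<Rightarrow> 'a"
  assumes V: "finite V" and I: "finite I"
    and f: "\<And>i. i \<in> I \<Longrightarrow> f i \<in> fun_space.span (monomials V 1)"
  shows "card (range (\<lambda>x. {i \<in> I. f i x \<noteq> 0})) \<le> (card I + 1) ^ card V"
proof -
  define pat where "pat = (\<lambda>x. {i \<in> I. f i x \<noteq> 0})"
  define P where "P = range pat"
  have PI: "p \<subseteq> I" if "p \<in> P" for p using that by (auto simp: P_def pat_def)
  have finP: "finite P" using PI I by (meson PowI finite_Pow_iff finite_subset subsetI)
  define pt where "pt = inv_into UNIV pat"
  have pt: "pat (pt p) = p" if "p \<in> P" for p
    using that unfolding P_def pt_def by (rule f_inv_into_f)
  define g where "g = (\<lambda>p x. \<Prod>i\<in>p. f i x)"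
  have g_nz: "g p (pt p') \<noteq> 0 \<longleftrightarrow> p \<subseteq> p'" if "p \<in> P" "p' \<in> P" for p p'
  proof -
    have "finite p" using PI[OF that(1)] I finite_subset by blast
    then have "g p (pt p') \<noteq> 0 \<longleftrightarrow> p \<subseteq> pat (pt p')"
      using PI[OF that(1)] by (auto simp: g_def pat_def)
    then show ?thesis using pt[OF that(2)] by simp
  qed
  have inj: "inj_on g P"
    by (rule inj_onI) (metis g_nz order_refl subset_antisym)
  \<comment> \<open>By \<open>g_nz\<close> the evaluation matrix is triangular with respect to inclusion.\<close>
  have "fun_space.independent (g ` P)"
  proof
    assume "fun_space.dependent (g ` P)"
    then obtain u where u: "\<exists>w\<in>g ` P. u w \<noteq> 0" "(\<Sum>w\<in>g ` P. (\<lambda>x. u w * w x)) = 0"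
      using fun_space.dependent_finite[of "g ` P"] finP by auto
    define Q where "Q = {p \<in> P. u (g p) \<noteq> 0}"
    have "finite Q" "Q \<noteq> {}" using finP u(1) by (auto simp: Q_def)
    \<comment> \<open>Evaluation at \<open>pt p\<close> kills every \<open>g p'\<close> with
      \<open>p'\<close> not contained in \<open>p\<close>; as \<open>p\<close> is minimal among the
      patterns with nonzero coefficient, only its own term survives.\<close>
    then obtain p where p: "p \<in> Q" "\<And>p'. p' \<in> Q \<Longrightarrow> p' \<subseteq> p \<Longrightarrow> p' = p"
      using finite_has_minimal[of Q] by (metis)
    have pP: "p \<in> P" using p by (simp add: Q_def)
    have "0 = (\<Sum>w\<in>g ` P. u w * w (pt p))"
      using fun_cong[OF u(2), of "pt p"] by (simp add: sum_fun_apply)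
    also have "\<dots> = (\<Sum>p'\<in>P. u (g p') * g p' (pt p))" using inj by (simp add: sum.reindex)
    also have "\<dots> = (\<Sum>p'\<in>{p}. u (g p') * g p' (pt p))"
      using finP pP p g_nz[OF _ pP] by (intro sum.mono_neutral_right) (auto simp: Q_def)
    also have "\<dots> \<noteq> 0" using g_nz[OF pP pP] p(1) by (simp add: Q_def)
    finally show False by simp
  qed
  moreover have "g ` P \<subseteq> fun_space.span (monomials V (card I))"
  proof safe
    fix p assume p: "p \<in> P"
    have "g p \<in> fun_space.span (monomials V (card p))"
      unfolding g_def using PI[OF p] I f by (intro prod_in_span_monomials) (auto intro: finite_subset)
    also have "\<dots> \<subseteq> fun_space.span (monomials V (card I))"
      using PI[OF p] I by (intro fun_space.span_mono monomials_mono card_mono)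
    finally show "g p \<in> fun_space.span (monomials V (card I))" .
  qed
  ultimately have "card (g ` P) \<le> card (monomials V (card I) :: (('v \<Rightarrow> 'a) \<Rightarrow> 'a) set)"
    using fun_space.independent_span_bound[OF finite_monomials[OF V]] by blast
  also have "\<dots> \<le> (card I + 1) ^ card V" by (rule card_monomials_le[OF V])
  finally show ?thesis using inj by (simp add: card_image P_def pat_def)
qed

section \<open>Factorization of low-rank matrices\<close>

text \<open>A maximal independent set \<open>S\<close> of columns spans all columns and has as many
  elements as the rank. Its vectors give the left factor, the coordinates of the columns of
  \<open>B\<close> the right one.\<close>

lemma rank_factorization:
  fixes B :: "'a::field mat"
  assumes B: "B \<in> carrier_mat n m" and k: "vec_space.rank n B \<le> k"
  shows "\<exists>u v. \<forall>i<n. \<forall>j<m. B $$ (i, j) = (\<Sum>l<k. u i l * v j l)"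
proof -
  interpret vec_space "TYPE('a)" n .
  let ?C = "set (cols B)"
  have C: "?C \<subseteq> carrier_vec n" using B cols_dim by blast
  obtain S where S: "finite S" "maximal S (\<lambda>T. T \<subseteq> ?C \<and> lin_indpt T)"
    using maximal_exists_superset[of ?C "\<lambda>T. T \<subseteq> ?C \<and> lin_indpt T" "{}"]
    by (auto simp: finite_lin_indpt2)
  have SC: "S \<subseteq> ?C" "lin_indpt S" using S(2) by (auto simp: maximal_def)
  have cS: "card S \<le> k" using rank_card_indpt[OF B S(2)] k by simp
  have spn: "c \<in> span S" if c: "c \<in> ?C" for c
  proof (rule ccontr)
    assume n: "c \<notin> span S"
    then have "c \<notin> S" using SC C span_mem by blast
    moreover have "lin_indpt (insert c S)"
      using n SC C c lin_dep_iff_in_span[of S c] \<open>c \<notin> S\<close> by auto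
    ultimately show False using S(2) c SC unfolding maximal_def by blast
  qed
  obtain s where s: "bij_betw s {..<card S} S"
    using S(1) by (metis atLeast0LessThan ex_bij_betw_nat_finite)
  have "\<exists>a. lincomb a S = col B j" if "j < m" for j
  proof -
    have "col B j \<in> ?C" using that B by (metis carrier_matD(2) cols_length cols_nth nth_mem)
    then show ?thesis using spn finite_span[OF S(1)] SC C by fastforce
  qed
  then obtain a where a: "\<And>j. j < m \<Longrightarrow> lincomb (a j) S = col B j" by metis
  \<comment> \<open>Zero padding in \<open>u\<close> raises the inner dimension from
    \<open>card S\<close> to \<open>k\<close>.\<close>
  define u where "u = (\<lambda>i l. if l < card S then s l $ i else 0)"
  define v where "v = (\<lambda>j l. a j (s l))"
  have "B $$ (i, j) = (\<Sum>l<k. u i l * v j l)" if ij: "i < n" "j < m" for i j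
  proof -
    have "B $$ (i, j) = lincomb (a j) S $ i" using a ij B by simp
    also have "\<dots> = (\<Sum>x\<in>S. a j x * x $ i)" using SC C ij by (intro lincomb_index) auto
    also have "\<dots> = (\<Sum>l<card S. a j (s l) * s l $ i)"
      using s by (subst sum.reindex_bij_betw[symmetric]) auto
    also have "\<dots> = (\<Sum>l<k. u i l * v j l)"
      using cS by (intro sum.mono_neutral_cong_left) (auto simp: u_def v_def)
    finally show ?thesis .
  qed
  then show ?thesis by blast
qed

section \<open>Half graphs\<close>

text \<open>Index pairs of the edges \<open>a i ~ b j\<close> of a half graph with \<open>s\<close>
  vertices on each side.\<close>

definition staircase :: "nat \<Rightarrow> (nat \<times> nat) set" where
  "staircase s = (SIGMA i:{..<s}. {..i})"

lemma card_staircase: "2 * card (staircase s) = s * (s + 1)"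
proof -
  have "2 * (\<Sum>i<s. Suc i) = s * (s + 1)" by (induction s) auto
  then show ?thesis by (simp add: staircase_def)
qed

text \<open>Makes the hypergraph of half graphs uniform: no two staircase pairs give the same edge,
  even where the ranges of \<open>a\<close> and \<open>b\<close> overlap.\<close>

lemma staircase_edges_inj:
  assumes a: "inj_on a {..<s}" and b: "inj_on b {..<s}"
    and ab: "\<And>i j. (i, j) \<in> staircase s \<Longrightarrow> a i \<noteq> b j"
  shows "inj_on (\<lambda>(i, j). {a i, b j}) (staircase s)"
proof (rule inj_onI, clarify)
  fix i j i' j'
  assume ij: "(i, j) \<in> staircase s" "(i', j') \<in> staircase s" and eq: "{a i, b j} = {a i', b j'}"
  then have s: "i < s" "j < s" "i' < s" "j' < s" "j \<le> i" "j' \<le> i'" by (auto simp: staircase_def)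
  consider "a i = a i'" "b j = b j'" | "a i = b j'" "a i' = b j"
    using eq by (auto simp: doubleton_eq_iff)
  then show "i = i' \<and> j = j'"
  proof cases
    case 1
    then show ?thesis using a b s by (auto dest: inj_onD)
  next
    case 2
    \<comment> \<open>The crossed identification would force
      \<open>i < j' \<le> i' < j \<le> i\<close>.\<close>
    then have "(i, j') \<notin> staircase s" "(i', j) \<notin> staircase s" using ab by blast+
    then show ?thesis using s by (auto simp: staircase_def)
  qed
qed

definition edges_on :: "nat \<Rightarrow> nat set set" where
  "edges_on n = {e. e \<subseteq> {..<n} \<and> card e = 2}"

text \<open>The ranges of \<open>a\<close> and \<open>b\<close> may overlap because rows and columns
  are indexed by the same vertices. For \<open>S \<subseteq> edges_on n\<close>, a coincidence
  \<open>a i = b j\<close> on the staircase gives a singleton, which is outside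
  \<open>S\<close>.\<close>

definition half_graph_free :: "nat \<Rightarrow> nat \<Rightarrow> nat set set \<Rightarrow> bool" where
  "half_graph_free n s S \<longleftrightarrow> (\<forall>a b. inj_on a {..<s} \<longrightarrow> inj_on b {..<s} \<longrightarrow>
     a ` {..<s} \<subseteq> {..<n} \<longrightarrow> b ` {..<s} \<subseteq> {..<n} \<longrightarrow> (\<exists>i j. (i, j) \<in> staircase s \<and> {a i, b j} \<notin> S))"

lemma half_graph_free_subset: "half_graph_free n s S \<Longrightarrow> S' \<subseteq> S \<Longrightarrow> half_graph_free n s S'"
  unfolding half_graph_free_def by (meson subsetD)

text \<open>In the hypergraph used here the points are the edges of the complete graph and the
  hyperedges are the edge sets of half graphs. Choosing \<open>2 * s\<close> vertices gives at most
  \<open>n ^ (2 * s)\<close> of them.\<close>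

lemma exists_half_graph_free:
  assumes "s > 0" "q > 0" "n ^ (2 * s) < q ^ (card (staircase s) - 1)"
  shows "\<exists>S\<subseteq>edges_on n. half_graph_free n s S \<and> n choose 2 \<le> q * card S"
proof -
  define I where "I = {(a, b). a \<in> {..<s} \<rightarrow>\<^sub>E {..<n} \<and> b \<in> {..<s} \<rightarrow>\<^sub>E {..<n} \<and>
    inj_on a {..<s} \<and> inj_on b {..<s} \<and> (\<forall>(i, j)\<in>staircase s. a i \<noteq> b j)}"
  define h where "h = (\<lambda>(a :: nat \<Rightarrow> nat, b). (\<lambda>(i, j). {a i, b j}) ` staircase s)"
  let ?F = "{..<s} \<rightarrow>\<^sub>E {..<n}"
  have sub: "I \<subseteq> ?F \<times> ?F" by (auto simp: I_def)
  have fin: "finite (?F \<times> ?F)" by (auto intro!: finite_PiE)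
  have "card I \<le> card (?F \<times> ?F)" by (rule card_mono[OF fin sub])
  also have "\<dots> = n ^ (2 * s)" by (simp add: card_cartesian_product card_funcsetE mult_2 power_add)
  finally have cI: "card I < q ^ (card (staircase s) - 1)" using assms(3) by linarith
  have "0 < card (staircase s)" using card_staircase[of s] assms(1) by (cases "card (staircase s)") auto
  moreover have "h p \<subseteq> edges_on n" if "p \<in> I" for p
    using that by (fastforce simp: I_def h_def edges_on_def staircase_def card_insert_if PiE_def Pi_def)
  moreover have "card (h p) = card (staircase s)" if "p \<in> I" for p
    using that by (auto simp: I_def h_def intro!: card_image staircase_edges_inj)
  moreover have "finite (edges_on n)" by (rule finite_subset[of _ "Pow {..<n}"]) (auto simp: edges_on_def)
  moreover have "finite I" by (rule finite_subset[OF sub fin])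
  ultimately obtain S where S: "S \<subseteq> edges_on n" "\<forall>p\<in>I. \<not> h p \<subseteq> S" "card (edges_on n) \<le> q * card S"
    using exists_large_independent_set[of "edges_on n" I h "card (staircase s)" q] cI assms(2) by blast
  have "half_graph_free n s S"
    unfolding half_graph_free_def
  proof (intro allI impI, rule ccontr)
    fix a b :: "nat \<Rightarrow> nat"
    assume ab: "inj_on a {..<s}" "inj_on b {..<s}" "a ` {..<s} \<subseteq> {..<n}" "b ` {..<s} \<subseteq> {..<n}"
      and "\<not> (\<exists>i j. (i, j) \<in> staircase s \<and> {a i, b j} \<notin> S)"
    then have in_S: "{a i, b j} \<in> S" if "(i, j) \<in> staircase s" for i j using that by blast
    have ne: "a i \<noteq> b j" if "(i, j) \<in> staircase s" for i j
      using S(1) in_S[OF that] by (auto simp: edges_on_def)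
    have st: "i < s" "j < s" if "(i, j) \<in> staircase s" for i j using that by (auto simp: staircase_def)
    let ?p = "(restrict a {..<s}, restrict b {..<s})"
    have "\<forall>(i, j)\<in>staircase s. restrict a {..<s} i \<noteq> restrict b {..<s} j"
      using ne st by auto
    moreover have "restrict a {..<s} \<in> ?F" "restrict b {..<s} \<in> ?F" using ab(3,4) by auto
    ultimately have "?p \<in> I" using ab(1,2) by (simp add: I_def)
    moreover have "h ?p \<subseteq> S" using in_S st by (auto simp: h_def)
    ultimately show False using S(2) by blast
  qed
  moreover have "card (edges_on n) = n choose 2"
    unfolding edges_on_def using n_subsets[of "{..<n}" 2] by simp
  ultimately show ?thesis using S(1,3) by auto
qed

text \<open>Unordered pairs make the matrix symmetric. If \<open>S \<subseteq> edges_on n\<close>,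
  the singleton \<open>{i, i}\<close> is outside \<open>S\<close>, so the diagonal consists of
  ones.\<close>

definition non_edge_mat :: "nat \<Rightarrow> nat set set \<Rightarrow> int mat" where
  "non_edge_mat n S = mat n n (\<lambda>(i, j). if {i, j} \<in> S then 0 else 1)"

lemma him_non_edge_mat_le:
  assumes free: "half_graph_free n s S"
  shows "him (non_edge_mat n S) \<le> s"
  unfolding him_le_iff
proof (intro allI impI, rule ccontr)
  fix r
  assume "has_half_induced_matching (non_edge_mat n S) r" and "\<not> r \<le> s"
  then obtain f g where r: "s < r" and fg: "inj_on f {..<r}" "f ` {..<r} \<subseteq> {..<n}"
      "inj_on g {..<r}" "g ` {..<r} \<subseteq> {..<n}"
    and tri: "upper_triangular (select_mat (non_edge_mat n S) r f g) \<or>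
             upper_triangular (transpose_mat (select_mat (non_edge_mat n S) r f g))"
    unfolding has_half_induced_matching_def by (auto simp: non_edge_mat_def)
  \<comment> \<open>The first row and the last column of a triangular submatrix carry no forced zeros; dropping
    them saves two vertices, without which the exponents would not suffice.\<close>
  have no: False if a: "inj_on a {..<r}" "a ` {..<r} \<subseteq> {..<n}" and b: "inj_on b {..<r}" "b ` {..<r} \<subseteq> {..<n}"
    and S: "\<And>i j. j < i \<Longrightarrow> i < r \<Longrightarrow> {a i, b j} \<in> S" for a b
  proof -
    have "inj_on (\<lambda>i. a (Suc i)) {..<s}"
      using a(1) r by (auto intro!: inj_onI dest: inj_onD)
    moreover have "inj_on b {..<s}" "(\<lambda>i. a (Suc i)) ` {..<s} \<subseteq> {..<n}" "b ` {..<s} \<subseteq> {..<n}"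
      using a b r by (auto simp: inj_on_def image_subset_iff)
    ultimately obtain i j where "(i, j) \<in> staircase s" "{a (Suc i), b j} \<notin> S"
      using free unfolding half_graph_free_def by blast
    then show False using S[of j "Suc i"] r by (auto simp: staircase_def)
  qed
  have in_n: "f i < n" "g i < n" if "i < r" for i using fg that by auto
  from tri show False
  proof
    assume *: "upper_triangular (select_mat (non_edge_mat n S) r f g)"
    have "{f i, g j} \<in> S" if "j < i" "i < r" for i j
      using upper_triangularD[OF *, of j i] that in_n
      by (auto simp: select_mat_def non_edge_mat_def split: if_splits)
    then show False using no fg by blast
  next
    assume *: "upper_triangular (transpose_mat (select_mat (non_edge_mat n S) r f g))"
    \<comment> \<open>Transposition exchanges rows and columns; edges are unordered, so
      \<open>no\<close> applies with \<open>f\<close> and \<open>g\<close> interchanged.\<close>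
    have "{g i, f j} \<in> S" if "j < i" "i < r" for i j
      using upper_triangularD[OF *, of j i] that in_n
      by (auto simp: select_mat_def non_edge_mat_def insert_commute split: if_splits)
    then show False using no fg by blast
  qed
qed

section \<open>Supports of low-rank matrices\<close>

text \<open>The Boolean tag keeps the entries of the two factors apart as variables, so even for
  \<open>i = j\<close> no variable is squared.\<close>

lemma bilinear_in_span_monomials:
  fixes V :: "(bool \<times> nat \<times> nat) set"
  assumes "finite V" and V: "\<And>l. l < k \<Longrightarrow> (False, i, l) \<in> V \<and> (True, j, l) \<in> V"
  shows "(\<lambda>x :: _ \<Rightarrow> 'a::field. \<Sum>l<k. x (False, i, l) * x (True, j, l)) \<in> fun_space.span (monomials V 1)"
proof -
  have "(\<lambda>x :: _ \<Rightarrow> 'a. x (False, i, l) * x (True, j, l)) \<in> monomials V 1" if l: "l < k" for l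
  proof -
    let ?W = "{(False, i, l), (True, j, l)}"
    have "(\<lambda>x :: _ \<Rightarrow> 'a. x (False, i, l) * x (True, j, l)) = (\<lambda>x. \<Prod>v\<in>?W. x v ^ (if v \<in> ?W then 1 else 0))"
      by auto
    also have "\<dots> = (\<lambda>x. \<Prod>v\<in>V. x v ^ (if v \<in> ?W then 1 else 0))"
      using V[OF l] assms(1) by (intro ext prod.mono_neutral_left) auto
    also have "\<dots> \<in> monomials V 1" by (rule monomialI) auto
    finally show ?thesis .
  qed
  then have "(\<Sum>l<k. (\<lambda>x :: _ \<Rightarrow> 'a. x (False, i, l) * x (True, j, l))) \<in> fun_space.span (monomials V 1)"
    by (intro fun_space.span_sum fun_space.span_base) auto
  also have "(\<Sum>l<k. (\<lambda>x :: _ \<Rightarrow> 'a. x (False, i, l) * x (True, j, l))) =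
      (\<lambda>x. \<Sum>l<k. x (False, i, l) * x (True, j, l))"
    by (simp add: fun_eq_iff sum_fun_apply)
  finally show ?thesis .
qed

text \<open>Otherwise each \<open>T \<subseteq> S\<close> comes from a matrix of rank at most
  \<open>k\<close>. Factorization turns these \<open>2 ^ card S\<close> supports into distinct zero
  patterns of \<open>n * n\<close> bilinear forms in \<open>2 * n * k\<close> variables, which is
  too many.\<close>

lemma exists_high_rank_subpattern:
  assumes S: "S \<subseteq> edges_on n" and many: "(n * n + 1) ^ (2 * n * k) < 2 ^ card S"
  shows "\<exists>S'\<subseteq>S. \<forall>B\<in>carrier_mat n n.
    same_support (non_edge_mat n S') (B :: 'a::field mat) \<longrightarrow> k < vec_space.rank n B"
proof (rule ccontr)
  let ?I = "{..<n} \<times> {..<n}"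
  define V :: "(bool \<times> nat \<times> nat) set" where "V = UNIV \<times> {..<n} \<times> {..<k}"
  have V: "finite V" "card V = 2 * n * k" by (auto simp: V_def card_cartesian_product)
  define f where "f = (\<lambda>(i :: nat, j :: nat) x. \<Sum>l<k. x (False, i, l) * (x (True, j, l) :: 'a))"
  define pat where "pat = (\<lambda>x. {p \<in> ?I. f p x \<noteq> 0})"
  assume no: "\<not> ?thesis"
  have ex: "\<exists>x. pat x = {(i, j) \<in> ?I. {i, j} \<notin> T}" if T: "T \<subseteq> S" for T
  proof -
    obtain B :: "'a mat" where B: "B \<in> carrier_mat n n" "same_support (non_edge_mat n T) B" "vec_space.rank n B \<le> k"
      using no T by (meson not_le)
    obtain u v where uv: "\<And>i j. i < n \<Longrightarrow> j < n \<Longrightarrow> B $$ (i, j) = (\<Sum>l<k. u i l * v j l)"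
      using rank_factorization[OF B(1,3)] by blast
    have "B $$ (i, j) = 0 \<longleftrightarrow> {i, j} \<in> T" if "i < n" "j < n" for i j
      using B(2) that by (auto simp: same_support_def non_edge_mat_def)
    then have "pat (\<lambda>(c, i, l). if c then v i l else u i l) = {(i, j) \<in> ?I. {i, j} \<notin> T}"
      using uv by (auto simp: pat_def f_def)
    then show ?thesis by blast
  qed
  define x where "x = (\<lambda>T. SOME x. pat x = {(i, j) \<in> ?I. {i, j} \<notin> T})"
  have x: "pat (x T) = {(i, j) \<in> ?I. {i, j} \<notin> T}" if "T \<subseteq> S" for T
    unfolding x_def using ex[OF that] by (rule someI_ex)
  have "inj_on (\<lambda>T. pat (x T)) (Pow S)"
  proof (rule inj_onI)
    fix T T' assume T: "T \<in> Pow S" "T' \<in> Pow S" "pat (x T) = pat (x T')"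
    have "e \<in> T \<longleftrightarrow> e \<in> T'" if e: "e \<in> S" for e
    proof -
      obtain i j where ij: "e = {i, j}" "i < n" "j < n"
        using S e unfolding edges_on_def by (auto simp: card_2_iff)
      have "(i, j) \<in> pat (x T) \<longleftrightarrow> (i, j) \<in> pat (x T')" using T(3) by simp
      then show ?thesis using ij T(1,2) by (simp add: x)
    qed
    then show "T = T'" using T by blast
  qed
  moreover have "(\<lambda>T. pat (x T)) ` Pow S \<subseteq> range pat" by blast
  moreover have "finite (range pat)" by (rule finite_subset[of _ "Pow ?I"]) (auto simp: pat_def)
  ultimately have "card (Pow S) \<le> card (range pat)" by (rule card_inj_on_le)
  also have "\<dots> \<le> (card ?I + 1) ^ card V"
    unfolding pat_def using V by (intro card_zero_patterns_le)
      (auto simp: f_def V_def simp del: One_nat_def intro!: bilinear_in_span_monomials)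
  finally have "card (Pow S) \<le> (n * n + 1) ^ (2 * n * k)" using V by (simp add: card_cartesian_product)
  moreover have "finite S"
    using S by (rule finite_subset) (rule finite_subset[of _ "Pow {..<n}"], auto simp: edges_on_def)
  ultimately show False using many by (metis card_Pow leD)
qed

section \<open>Asymptotics and choice of parameters\<close>

text \<open>Serves for \<open>a = 2 / t\<close> and \<open>b\<close> the growth exponent of the
  number of colours. The quotient of the sides has order \<open>n powr (b - a) * ln n\<close> and
  tends to 0; the \<open>+ 1\<close> next to \<open>n powr b\<close> allows for rounding up.\<close>

lemma asymptotic_slack:
  fixes a b :: real
  assumes "0 < b" "b < a"
  shows "\<forall>\<^sub>F n :: nat in sequentially.
    4 * (real n powr b + 1) * (real n * real n powr (1 - a) * ln (real n * real n + 1)) < ln 2 * (real n * (real n - 1))"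
proof -
  define d where "d = a - b"
  have d: "d > 0" using assms by (simp add: d_def)
  have "\<forall>\<^sub>F n :: nat in sequentially. 8 * (real n powr (- d) * ln (real n * real n + 1)) < ln 2 * (1 - 1 / real n)"
    using d by real_asymp
  moreover have "\<forall>\<^sub>F n :: nat in sequentially. n \<ge> 1" by (rule eventually_ge_at_top)
  ultimately show ?thesis
  proof eventually_elim
    case (elim n)
    then have n: "real n \<ge> 1" by simp
    let ?L = "ln (real n * real n + 1)"
    have L: "?L \<ge> 0" using n by simp
    have "real n powr b \<ge> 1" using n assms by (simp add: ge_one_powr_ge_zero)
    then have "4 * (real n powr b + 1) * (real n * real n powr (1 - a) * ?L)
      \<le> 4 * (2 * real n powr b) * (real n * real n powr (1 - a) * ?L)"
      using n L by (intro mult_right_mono mult_left_mono mult_nonneg_nonneg) auto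
    also have "\<dots> = 8 * (real n powr b * real n powr (1 - a)) * real n * ?L" by (simp add: mult_ac)
    also have "real n powr b * real n powr (1 - a) = real n powr (- d) * real n"
      using n by (simp add: d_def powr_add[symmetric] powr_mult_base algebra_simps)
    also have "8 * (real n powr (- d) * real n) * real n * ?L = (8 * (real n powr (- d) * ?L)) * (real n * real n)"
      by (simp add: mult_ac)
    also have "\<dots> < ln 2 * (1 - 1 / real n) * (real n * real n)"
      using elim n by (intro mult_strict_right_mono) auto
    also have "\<dots> = ln 2 * (real n * (real n - 1))" using n by (simp add: field_simps)
    finally show ?case .
  qed
qed

theorem theorem42:
  fixes t :: nat
  assumes "t \<ge> 3"
  shows "\<forall>\<^sub>F n in sequentially.
    \<exists>A \<in> carrier_mat n n. zero_one_mat A \<and> transpose_mat A = A \<and> (\<forall>i<n. A $$ (i, i) = 1) \<and>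
      him A \<le> 2 * t \<and>
      (\<forall>B \<in> carrier_mat n n. same_support A (B :: 'a::field mat) \<longrightarrow>
         real (vec_space.rank n B) \<ge> real n powr (1 - 2 / real t))"
proof -
  define m where "m = card (staircase (2 * t)) - 1"
  \<comment> \<open>A half graph has \<open>4 * t\<close> vertices; the extra 1 gives the strict
    inequality \<open>n ^ (4 * t) < (n powr b) ^ m\<close> that the colouring needs.\<close>
  define b where "b = (4 * real t + 1) / real m"
  have "m = t * (2 * t + 1) - 1" using card_staircase[of "2 * t"] by (simp add: m_def algebra_simps)
  moreover have "t * (2 * t + 1) \<ge> 1" using assms by (simp add: Suc_leI)
  ultimately have m: "real m = 2 * real t * real t + real t - 1"
    by (simp add: of_nat_diff algebra_simps)
  have "real t * real t \<ge> 0" by simp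
  then have mpos: "real m > 0" unfolding m using assms by linarith
  \<comment> \<open>After clearing denominators the upper bound reads
    \<open>t * (4 * t + 1) < 4 * t * t + 2 * t - 2\<close>, that is, \<open>t > 2\<close>.\<close>
  have b: "0 < b" "b < 2 / real t"
    using assms mpos by (auto simp: b_def field_simps) (simp add: m algebra_simps)
  show ?thesis using asymptotic_slack[OF b] eventually_ge_at_top[of "2 :: nat"]
  proof eventually_elim
    case (elim n)
    \<comment> \<open>Rounding \<open>q\<close> up keeps \<open>q ^ m\<close> large enough. Rounding
      \<open>k\<close> down is harmless, since a rank above \<open>k\<close> is at least
      \<open>k + 1\<close>, which exceeds the real bound.\<close>
    define q where "q = nat \<lceil>real n powr b\<rceil>"
    define k where "k = nat \<lfloor>real n powr (1 - 2 / real t)\<rfloor>"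
    have n: "real n > 1" using elim(2) by simp
    have q: "real n powr b \<le> real q" "real q \<le> real n powr b + 1"
      using powr_ge_zero[of "real n" b] unfolding q_def by linarith+
    have "0 < real n powr b" using n by simp
    then have q0: "q > 0" using q(1) by linarith
    have k: "real k \<le> real n powr (1 - 2 / real t)" "real n powr (1 - 2 / real t) < real k + 1"
      using powr_ge_zero[of "real n" "1 - 2 / real t"] unfolding k_def by linarith+
    have "real (n ^ (4 * t)) = real n powr (4 * real t)" using n by (simp add: powr_realpow[symmetric])
    also have "\<dots> < real n powr (4 * real t + 1)" using n by simp
    also have "\<dots> = (real n powr b) powr (real m)" using mpos by (simp add: powr_powr b_def)
    also have "\<dots> = (real n powr b) ^ m" using n by (simp add: powr_realpow)
    also have "\<dots> \<le> real (q ^ m)" using q by (simp add: power_mono)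
    finally have "n ^ (2 * (2 * t)) < q ^ m" by (subst (asm) of_nat_less_iff) simp
    then obtain S where S: "S \<subseteq> edges_on n" "half_graph_free n (2 * t) S" "n choose 2 \<le> q * card S"
      using exists_half_graph_free[of "2 * t" q n] q0 assms by (auto simp: m_def)
    let ?L = "ln (real n * real n + 1)"
    have L: "?L > 0" using n by (simp add: ln_gt_zero)
    \<comment> \<open>The goal is \<open>2 * n * k * ?L < card S * ln 2\<close>, the logarithm of
      the counting condition. It is multiplied by \<open>2 * q\<close> so that
      \<open>n choose 2 \<le> q * card S\<close> can be inserted.\<close>
    have "4 * real q * (real n * real k * ?L)
      \<le> 4 * (real n powr b + 1) * (real n * real n powr (1 - 2 / real t) * ?L)"
      using q k n L by (intro mult_mono) auto
    also have "\<dots> < ln 2 * (real n * (real n - 1))" by (rule elim(1))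
    also have "real n * (real n - 1) = 2 * real (n choose 2)"
      using elim(2) by (simp add: choose_two real_of_nat_div of_nat_diff)
    also have "ln 2 * (2 * real (n choose 2)) \<le> ln 2 * (2 * real (q * card S))"
      using S(3) by (intro mult_left_mono) (auto simp del: of_nat_mult)
    finally have "real q * (2 * real n * real k * ?L) < real q * (real (card S) * ln 2)"
      by (simp add: mult_ac)
    then have "2 * real n * real k * ?L < real (card S) * ln 2" using q0 by simp
    then have "ln ((real n * real n + 1) ^ (2 * n * k)) < ln (2 ^ card S)"
      using n by (simp add: ln_realpow)
    then have "(real n * real n + 1) ^ (2 * n * k) < 2 ^ card S"
      using n by (subst (asm) ln_less_cancel_iff) (auto intro!: zero_less_power add_nonneg_pos)
    then have "real ((n * n + 1) ^ (2 * n * k)) < real (2 ^ card S)" by (simp add: add.commute)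
    then have "(n * n + 1) ^ (2 * n * k) < 2 ^ card S" by (simp only: of_nat_less_iff)
    then obtain S' where S': "S' \<subseteq> S" "\<forall>B\<in>carrier_mat n n.
        same_support (non_edge_mat n S') (B :: 'a mat) \<longrightarrow> k < vec_space.rank n B"
      using exists_high_rank_subpattern[OF S(1)] by blast
    let ?A = "non_edge_mat n S'"
    have "zero_one_mat ?A" by (auto simp: zero_one_mat_def non_edge_mat_def elements_mat_def)
    moreover have "transpose_mat ?A = ?A"
      by (rule eq_matI) (auto simp: non_edge_mat_def insert_commute)
    moreover have "?A $$ (i, i) = 1" if "i < n" for i
      using that S(1) S'(1) by (auto simp: non_edge_mat_def edges_on_def)
    moreover have "him ?A \<le> 2 * t"
      by (rule him_non_edge_mat_le[OF half_graph_free_subset[OF S(2) S'(1)]])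
    moreover have "real n powr (1 - 2 / real t) \<le> real (vec_space.rank n B)"
      if "B \<in> carrier_mat n n" "same_support ?A B" for B :: "'a mat"
    proof -
      have "k < vec_space.rank n B" using S'(2) that by blast
      then show ?thesis using k(2) by linarith
    qed
    ultimately show ?case
      by (intro bexI[of _ ?A]) (auto simp: non_edge_mat_def)
  qed
qed

end
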